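(* Let $G$ be a group and $A$ a subset of $G$. (1) If $G$ is right-orderable, then the rack $R(G,A)$ is right-orderable. (2) If $G$ is bi-orderable, then the quandle $Q(G,A)$ is right-orderable.
   Context: A group is right-orderable if it has a (strict) linear order preserved by right multiplications, and bi-orderable if it has a linear order preserved by both left and right multiplications. A rack is a set with a binary operation $*$ such that for all $x,y$ there is a unique $z$ with $x=z*y$, and $(x*y)*z=(x*z)*(y*z)$ for all $x,y,z$; a quandle is a non-empty rack with $x*x=x$ for all $x$. A rack or quandle is right-orderable if it has a (strict) linear order $<$ such that $x<y$ implies $x*z<y*z$ for all $x,y,z$. The $(G,A)$-rack $R(G,A)$ is the set $A\times G$ with operation $(a,u)*(b,v)=(a,uv^{-1}bv)$. The $(G,A)$-quandle $Q(G,A)$ is the quotient of $A\times G$ by the equivalence relation $(a,vu)\sim(a,u)$ if and only if $v\in C_G(a)=\{x\in G\mid xa=ax\}$, with the induced operation $[(a,u)]*[(b,v)]=[(a,uv^{-1}bv)]$. *)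

theory Defs
  imports "HOL-Algebra.Group"
begin

definition invariant_strict_order :: "'a set \<Rightarrow> ('a \<Rightarrow> 'a \<Rightarrow> 'a) \<Rightarrow> 'a rel \<Rightarrow> bool" where
  "invariant_strict_order X f r \<longleftrightarrow>
     r \<subseteq> X \<times> X \<and> strict_linear_order_on X r \<and>
     (\<forall>x\<in>X. \<forall>y\<in>X. \<forall>z\<in>X. (x, y) \<in> r \<longrightarrow> (f x z, f y z) \<in> r)"

text \<open>The same notion serves groups (with \<open>f\<close> the group multiplication) and racks.\<close>

definition right_orderable :: "'a set \<Rightarrow> ('a \<Rightarrow> 'a \<Rightarrow> 'a) \<Rightarrow> bool" where
  "right_orderable X f \<longleftrightarrow> (\<exists>r. invariant_strict_order X f r)"

text \<open>One and the same order has to be invariant on both sides.\<close>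

definition bi_orderable :: "'a set \<Rightarrow> ('a \<Rightarrow> 'a \<Rightarrow> 'a) \<Rightarrow> bool" where
  "bi_orderable X f \<longleftrightarrow>
     (\<exists>r. invariant_strict_order X f r \<and> invariant_strict_order X (\<lambda>x y. f y x) r)"

definition rack :: "'a set \<Rightarrow> ('a \<Rightarrow> 'a \<Rightarrow> 'a) \<Rightarrow> bool" where
  "rack X f \<longleftrightarrow>
     (\<forall>x\<in>X. \<forall>y\<in>X. f x y \<in> X) \<and>
     (\<forall>x\<in>X. \<forall>y\<in>X. \<exists>!z. z \<in> X \<and> x = f z y) \<and>
     (\<forall>x\<in>X. \<forall>y\<in>X. \<forall>z\<in>X. f (f x y) z = f (f x z) (f y z))"

definition quandle :: "'a set \<Rightarrow> ('a \<Rightarrow> 'a \<Rightarrow> 'a) \<Rightarrow> bool" where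
  "quandle X f \<longleftrightarrow> rack X f \<and> X \<noteq> {} \<and> (\<forall>x\<in>X. f x x = x)"

definition GA_rack_carrier :: "('g, 'm) monoid_scheme \<Rightarrow> 'g set \<Rightarrow> ('g \<times> 'g) set" where
  "GA_rack_carrier G A = A \<times> carrier G"

definition GA_rack_op :: "('g, 'm) monoid_scheme \<Rightarrow> 'g \<times> 'g \<Rightarrow> 'g \<times> 'g \<Rightarrow> 'g \<times> 'g" where
  "GA_rack_op G = (\<lambda>(a, u) (b, v). (a, u \<otimes>\<^bsub>G\<^esub> inv\<^bsub>G\<^esub> v \<otimes>\<^bsub>G\<^esub> b \<otimes>\<^bsub>G\<^esub> v))"

definition element_centralizer :: "('g, 'm) monoid_scheme \<Rightarrow> 'g \<Rightarrow> 'g set" where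
  "element_centralizer G a = {x \<in> carrier G. x \<otimes>\<^bsub>G\<^esub> a = a \<otimes>\<^bsub>G\<^esub> x}"

definition GA_rel :: "('g, 'm) monoid_scheme \<Rightarrow> 'g set \<Rightarrow> ('g \<times> 'g) rel" where
  "GA_rel G A = {((a, v \<otimes>\<^bsub>G\<^esub> u), (a, u)) | a u v.
     a \<in> A \<and> u \<in> carrier G \<and> v \<in> element_centralizer G a}"

definition GA_quandle_carrier :: "('g, 'm) monoid_scheme \<Rightarrow> 'g set \<Rightarrow> ('g \<times> 'g) set set" where
  "GA_quandle_carrier G A = GA_rack_carrier G A // GA_rel G A"

text \<open>
  The operation on classes is given by the union over all representatives, which is a single
  class because the operation respects the equivalence relation; see \<open>GA_quandle_op_class\<close> below.
\<close>

definition GA_quandle_op ::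
  "('g, 'm) monoid_scheme \<Rightarrow> 'g set \<Rightarrow> ('g \<times> 'g) set \<Rightarrow> ('g \<times> 'g) set \<Rightarrow> ('g \<times> 'g) set" where
  "GA_quandle_op G A S T = (\<Union>p\<in>S. \<Union>q\<in>T. GA_rel G A `` {GA_rack_op G p q})"

context group
begin

lemma centralizer_one: "a \<in> carrier G \<Longrightarrow> \<one> \<in> element_centralizer G a"
  by (simp add: element_centralizer_def)

lemma centralizer_mult:
  assumes "a \<in> carrier G" "v \<in> element_centralizer G a" "w \<in> element_centralizer G a"
  shows "v \<otimes> w \<in> element_centralizer G a"
proof -
  have c: "v \<in> carrier G" "w \<in> carrier G" "v \<otimes> a = a \<otimes> v" "w \<otimes> a = a \<otimes> w"
    using assms by (auto simp: element_centralizer_def)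
  have "v \<otimes> w \<otimes> a = v \<otimes> (w \<otimes> a)" using c(1,2) assms(1) by (rule m_assoc)
  also have "\<dots> = v \<otimes> a \<otimes> w" unfolding c(4) using c(1,2) assms(1) by (simp only: m_assoc)
  also have "\<dots> = a \<otimes> (v \<otimes> w)" unfolding c(3) using c(1,2) assms(1) by (simp only: m_assoc)
  finally show ?thesis using c by (simp add: element_centralizer_def)
qed

lemma centralizer_inv:
  assumes "a \<in> carrier G" "v \<in> element_centralizer G a"
  shows "inv v \<in> element_centralizer G a"
proof -
  have c: "v \<in> carrier G" "v \<otimes> a = a \<otimes> v"
    using assms by (auto simp: element_centralizer_def)
  have "inv v \<otimes> a = inv v \<otimes> a \<otimes> v \<otimes> inv v"
    using c(1) assms(1) by (simp add: m_assoc)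
  also have "\<dots> = inv v \<otimes> (a \<otimes> v) \<otimes> inv v"
    using c(1) assms(1) by (simp add: m_assoc)
  also have "\<dots> = inv v \<otimes> v \<otimes> a \<otimes> inv v"
    unfolding c(2)[symmetric] using c(1) assms(1) by (simp only: m_assoc inv_closed m_closed)
  also have "\<dots> = a \<otimes> inv v" using c(1) assms(1) by simp
  finally have "inv v \<otimes> a = a \<otimes> inv v" .
  then show ?thesis using c by (simp add: element_centralizer_def)
qed

lemma GA_rel_equiv:
  assumes "A \<subseteq> carrier G"
  shows "equiv (GA_rack_carrier G A) (GA_rel G A)"
proof (rule equivI)
  show "GA_rel G A \<subseteq> GA_rack_carrier G A \<times> GA_rack_carrier G A"
    by (auto simp: GA_rel_def GA_rack_carrier_def element_centralizer_def)
  show "refl_on (GA_rack_carrier G A) (GA_rel G A)"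
  proof (rule refl_onI)
    fix p assume "p \<in> GA_rack_carrier G A"
    then obtain a u where p: "p = (a, u)" "a \<in> A" "u \<in> carrier G"
      by (auto simp: GA_rack_carrier_def)
    then have "p = (a, \<one> \<otimes> u)" by simp
    then show "(p, p) \<in> GA_rel G A"
      using p assms centralizer_one unfolding GA_rel_def by blast
  qed
  show "sym (GA_rel G A)"
  proof (rule symI)
    fix p q assume "(p, q) \<in> GA_rel G A"
    then obtain a u v where h: "p = (a, v \<otimes> u)" "q = (a, u)" "a \<in> A" "u \<in> carrier G"
      "v \<in> element_centralizer G a" unfolding GA_rel_def by blast
    then have v: "v \<in> carrier G" by (simp add: element_centralizer_def)
    have "q = (a, inv v \<otimes> (v \<otimes> u))" "v \<otimes> u \<in> carrier G"
      using h v by (simp_all add: m_assoc[symmetric])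
    then show "(q, p) \<in> GA_rel G A"
      using h assms centralizer_inv unfolding GA_rel_def by blast
  qed
  show "trans (GA_rel G A)"
  proof (rule transI)
    fix p q s assume "(p, q) \<in> GA_rel G A" "(q, s) \<in> GA_rel G A"
    then obtain a u v w where h: "p = (a, w \<otimes> (v \<otimes> u))" "s = (a, u)" "a \<in> A" "u \<in> carrier G"
      "v \<in> element_centralizer G a" "w \<in> element_centralizer G a"
      unfolding GA_rel_def by blast
    then have "p = (a, (w \<otimes> v) \<otimes> u)"
      by (simp add: element_centralizer_def m_assoc)
    then show "(p, s) \<in> GA_rel G A"
      using h assms centralizer_mult[of a w v] unfolding GA_rel_def by blast
  qed
qed

lemma GA_rack_op_respects:
  assumes "A \<subseteq> carrier G"
  shows "(\<lambda>p q. GA_rel G A `` {GA_rack_op G p q}) respects2 GA_rel G A"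
proof (rule congruent2I')
  fix p p' q q'
  assume "(p, p') \<in> GA_rel G A" "(q, q') \<in> GA_rel G A"
  then obtain a u v b y w where h: "p = (a, v \<otimes> u)" "p' = (a, u)" "a \<in> A" "u \<in> carrier G"
      "v \<in> element_centralizer G a" "q = (b, w \<otimes> y)" "q' = (b, y)" "b \<in> A" "y \<in> carrier G"
      "w \<in> element_centralizer G b"
    unfolding GA_rel_def by blast
  have c: "b \<in> carrier G" "v \<in> carrier G" "w \<in> carrier G" "w \<otimes> b = b \<otimes> w"
    using h assms by (auto simp: element_centralizer_def)
  have "inv w \<otimes> (b \<otimes> (w \<otimes> y)) = inv w \<otimes> (b \<otimes> w \<otimes> y)"
    using c(1-3) h(9) by (simp only: m_assoc)
  also have "\<dots> = inv w \<otimes> w \<otimes> (b \<otimes> y)"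
    unfolding c(4)[symmetric] using c(1-3) h(9) by (simp only: m_assoc inv_closed m_closed)
  also have "\<dots> = b \<otimes> y"
    using c(1-3) h(9) by simp
  finally have "inv w \<otimes> (b \<otimes> (w \<otimes> y)) = b \<otimes> y" .
  then have "v \<otimes> u \<otimes> inv (w \<otimes> y) \<otimes> b \<otimes> (w \<otimes> y) = v \<otimes> (u \<otimes> inv y \<otimes> b \<otimes> y)"
    using c(1-3) h(4,9) by (simp add: m_assoc inv_mult_group)
  then have "(GA_rack_op G p q, GA_rack_op G p' q') \<in> GA_rel G A"
    using h c(1-3) unfolding GA_rel_def GA_rack_op_def
    by (simp, intro exI[of _ "u \<otimes> inv y \<otimes> b \<otimes> y"] exI[of _ v]) simp
  then show "GA_rel G A `` {GA_rack_op G p q} = GA_rel G A `` {GA_rack_op G p' q'}"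
    using equiv_class_eq[OF GA_rel_equiv[OF assms]] by blast
qed

lemma GA_quandle_op_class:
  assumes "A \<subseteq> carrier G" "a \<in> A" "u \<in> carrier G" "b \<in> A" "v \<in> carrier G"
  shows "GA_quandle_op G A (GA_rel G A `` {(a, u)}) (GA_rel G A `` {(b, v)}) =
    GA_rel G A `` {(a, u \<otimes> inv v \<otimes> b \<otimes> v)}"
proof -
  have e: "equiv (GA_rack_carrier G A) (GA_rel G A)"
    and r: "(\<lambda>p q. GA_rel G A `` {GA_rack_op G p q}) respects2 GA_rel G A"
    using GA_rel_equiv GA_rack_op_respects assms by auto
  from UN_equiv_class2[OF e e r, of "(a, u)" "(b, v)"] show ?thesis
    using assms by (simp add: GA_quandle_op_def GA_rack_op_def GA_rack_carrier_def)
qed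

end

end

theory Submission
  imports Defs
begin

text \<open>
  In both cases the order is lexicographic. On the rack, compare \<open>(a, u)\<close> first by \<open>a\<close>, which the
  operation fixes, and then by \<open>u\<close>, on which the operation acts by a right multiplication. On the
  quandle, the class of \<open>(a, u)\<close> is determined by \<open>a\<close> and the conjugate \<open>u\<inverse> a u\<close>, on which the
  operation acts by a conjugation; conjugations preserve a bi-invariant order.
\<close>

section \<open>Orders on sets with an operation\<close>

text \<open>The lexicographic order is pulled back along the injection \<open>k\<close>. Right
  action by \<open>z\<close> fixes first coordinates, so a comparison decided there survives
  unchanged, and a tie stays a tie and is settled by the second coordinates, where
  \<open>snd_k\<close> applies.\<close>

lemma right_orderable_lex_key:
  assumes r: "strict_linear_order_on Y r"
    and k: "inj_on k X" "k ` X \<subseteq> Y \<times> Y"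
    and closed: "\<And>x z. x \<in> X \<Longrightarrow> z \<in> X \<Longrightarrow> f x z \<in> X"
    and fst_k: "\<And>x z. x \<in> X \<Longrightarrow> z \<in> X \<Longrightarrow> fst (k (f x z)) = fst (k x)"
    and snd_k: "\<And>x y z. x \<in> X \<Longrightarrow> y \<in> X \<Longrightarrow> z \<in> X \<Longrightarrow> (snd (k x), snd (k y)) \<in> r \<Longrightarrow>
      (snd (k (f x z)), snd (k (f y z))) \<in> r"
  shows "right_orderable X f"
proof -
  define s where "s = {(x, y) \<in> X \<times> X. (k x, k y) \<in> r <*lex*> r}"
  have s_iff: "(x, y) \<in> s \<longleftrightarrow> x \<in> X \<and> y \<in> X \<and>
      ((fst (k x), fst (k y)) \<in> r \<or> fst (k x) = fst (k y) \<and> (snd (k x), snd (k y)) \<in> r)" for x y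
    by (cases "k x"; cases "k y") (auto simp: s_def)
  have "trans s"
    using r unfolding strict_linear_order_on_def
    by (intro transI) (auto simp: s_iff dest: transD)
  moreover have "irrefl s"
    using r by (auto simp: strict_linear_order_on_def irrefl_def s_iff)
  moreover have "total_on X s"
  proof (rule total_onI)
    fix x y assume xy: "x \<in> X" "y \<in> X" "x \<noteq> y"
    \<comment> \<open>Injectivity gives distinct keys, which differ in some coordinate; totality of
      \<open>r\<close> on \<open>Y\<close> compares them at the first such coordinate.\<close>
    then have "k x \<noteq> k y" "k x \<in> Y \<times> Y" "k y \<in> Y \<times> Y"
      using k by (auto dest: inj_onD)
    then show "(x, y) \<in> s \<or> (y, x) \<in> s"
      using r xy unfolding strict_linear_order_on_def total_on_def s_iff
      by (metis mem_Times_iff prod_eqI)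
  qed
  moreover have "(f x z, f y z) \<in> s" if "(x, y) \<in> s" "z \<in> X" for x y z
    using that closed fst_k snd_k by (auto simp: s_iff)
  ultimately have "invariant_strict_order X f s"
    by (auto simp: invariant_strict_order_def strict_linear_order_on_def s_iff)
  then show ?thesis unfolding right_orderable_def by blast
qed

text \<open>If \<open>x\<close> and \<open>y\<close> were distinct, totality would make one smaller,
  and invariance would then place \<open>f x z\<close> strictly below itself.\<close>

lemma right_orderable_cancel:
  assumes "right_orderable X f" "x \<in> X" "y \<in> X" "z \<in> X" "f x z = f y z"
  shows "x = y"
  using assms unfolding right_orderable_def invariant_strict_order_def
    strict_linear_order_on_def total_on_def irrefl_def by metis

text \<open>Uniqueness of right division comes for free from the order.\<close>

lemma right_orderable_rackI:
  assumes "right_orderable X f"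
    and "\<And>x y. x \<in> X \<Longrightarrow> y \<in> X \<Longrightarrow> f x y \<in> X"
    and "\<And>x y. x \<in> X \<Longrightarrow> y \<in> X \<Longrightarrow> \<exists>z\<in>X. x = f z y"
    and "\<And>x y z. x \<in> X \<Longrightarrow> y \<in> X \<Longrightarrow> z \<in> X \<Longrightarrow> f (f x y) z = f (f x z) (f y z)"
  shows "rack X f"
proof -
  have "\<exists>!z. z \<in> X \<and> x = f z y" if "x \<in> X" "y \<in> X" for x y
    using assms(3)[OF that] right_orderable_cancel[OF assms(1) _ _ that(2)] by metis
  then show ?thesis
    unfolding rack_def by (intro conjI ballI assms(2,4))
qed

section \<open>Conjugates and the rack on pairs\<close>

context group
begin

text \<open>This is the group element through which a pair acts from the right on the rack. It takes
  a pair so that it applies directly to elements of the rack.\<close>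

definition conjugate :: "'a \<times> 'a \<Rightarrow> 'a" where
  "conjugate = (\<lambda>(a, u). inv u \<otimes> a \<otimes> u)"

lemma conjugate_closed: "a \<in> carrier G \<Longrightarrow> u \<in> carrier G \<Longrightarrow> conjugate (a, u) \<in> carrier G"
  by (simp add: conjugate_def)

lemma conjugate_mult:
  assumes "a \<in> carrier G" "u \<in> carrier G" "w \<in> carrier G"
  shows "conjugate (a, u \<otimes> w) = inv w \<otimes> conjugate (a, u) \<otimes> w"
  using assms by (simp add: conjugate_def inv_mult_group m_assoc)

lemma GA_rack_op_conjugate:
  assumes "u \<in> carrier G" "b \<in> carrier G" "v \<in> carrier G"
  shows "GA_rack_op G (a, u) (b, v) = (a, u \<otimes> conjugate (b, v))"
  using assms by (simp add: GA_rack_op_def conjugate_def m_assoc)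

lemma GA_rack_carrierE:
  assumes "p \<in> GA_rack_carrier G A" "A \<subseteq> carrier G"
  obtains a u where "p = (a, u)" "a \<in> A" "a \<in> carrier G" "u \<in> carrier G"
  using assms by (auto simp: GA_rack_carrier_def)

lemma GA_rack_op_closed:
  assumes "A \<subseteq> carrier G" "p \<in> GA_rack_carrier G A" "q \<in> GA_rack_carrier G A"
  shows "GA_rack_op G p q \<in> GA_rack_carrier G A"
  using assms by (auto simp: GA_rack_carrier_def GA_rack_op_def subset_iff)

lemma GA_rack_op_solvable:
  assumes A: "A \<subseteq> carrier G" and "p \<in> GA_rack_carrier G A" "q \<in> GA_rack_carrier G A"
  shows "\<exists>s\<in>GA_rack_carrier G A. p = GA_rack_op G s q"
proof -
  obtain a u where p: "p = (a, u)" "a \<in> A" "a \<in> carrier G" "u \<in> carrier G"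
    using assms(2) A by (rule GA_rack_carrierE)
  obtain b v where q: "q = (b, v)" "b \<in> carrier G" "v \<in> carrier G"
    using assms(3) A by (rule GA_rack_carrierE)
  note h = p q
  \<comment> \<open>Acting by \<open>q\<close> is right multiplication by its conjugate, so right
    multiplication by the inverse undoes it.\<close>
  let ?s = "(a, u \<otimes> inv (conjugate (b, v)))"
  have "p = GA_rack_op G ?s q"
    using h by (simp add: GA_rack_op_conjugate conjugate_closed m_assoc)
  moreover have "?s \<in> GA_rack_carrier G A"
    using h by (simp add: GA_rack_carrier_def conjugate_closed)
  ultimately show ?thesis by blast
qed

text \<open>Let \<open>x\<close> and \<open>y\<close> be the conjugates of \<open>q\<close> and
  \<open>s\<close>. Acting by \<open>s\<close> turns the conjugate of \<open>q\<close> into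
  \<open>inv y \<otimes> x \<otimes> y\<close>, so the right side multiplies \<open>u\<close> by
  \<open>y\<close> and then by this element, which cancels to \<open>x \<otimes> y\<close>.\<close>

lemma GA_rack_op_self_distrib:
  assumes A: "A \<subseteq> carrier G"
    and "p \<in> GA_rack_carrier G A" "q \<in> GA_rack_carrier G A" "s \<in> GA_rack_carrier G A"
  shows "GA_rack_op G (GA_rack_op G p q) s = GA_rack_op G (GA_rack_op G p s) (GA_rack_op G q s)"
proof -
  obtain a u where p: "p = (a, u)" "a \<in> carrier G" "u \<in> carrier G"
    using assms(2) A by (rule GA_rack_carrierE)
  obtain b v where q: "q = (b, v)" "b \<in> carrier G" "v \<in> carrier G"
    using assms(3) A by (rule GA_rack_carrierE)
  obtain c w where s: "s = (c, w)" "c \<in> carrier G" "w \<in> carrier G"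
    using assms(4) A by (rule GA_rack_carrierE)
  note h = p q s
  define x y where "x = conjugate (b, v)" and "y = conjugate (c, w)"
  have xy: "x \<in> carrier G" "y \<in> carrier G"
    using h by (auto simp: x_def y_def conjugate_closed)
  have "y \<otimes> (inv y \<otimes> (x \<otimes> y)) = y \<otimes> inv y \<otimes> (x \<otimes> y)"
    using xy by (simp only: m_assoc inv_closed m_closed)
  then have "u \<otimes> y \<otimes> (inv y \<otimes> x \<otimes> y) = u \<otimes> x \<otimes> y"
    using h xy by (simp add: m_assoc)
  then show ?thesis
    using h xy
    by (simp add: GA_rack_op_conjugate conjugate_mult x_def[symmetric] y_def[symmetric])
qed

lemma GA_rack_right_orderable:
  assumes A: "A \<subseteq> carrier G" and "right_orderable (carrier G) (mult G)"
  shows "right_orderable (GA_rack_carrier G A) (GA_rack_op G)"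
proof -
  obtain r where r: "strict_linear_order_on (carrier G) r"
    and r_mult: "\<And>x y z. z \<in> carrier G \<Longrightarrow> (x, y) \<in> r \<Longrightarrow> (x \<otimes> z, y \<otimes> z) \<in> r"
    using assms(2) unfolding right_orderable_def invariant_strict_order_def by blast
  show ?thesis
  \<comment> \<open>Elements of the rack are already pairs of group elements, so they serve as their
    own keys.\<close>
  proof (rule right_orderable_lex_key[OF r, where k = id])
    show "id ` GA_rack_carrier G A \<subseteq> carrier G \<times> carrier G"
      using A by (auto simp: GA_rack_carrier_def)
    fix p q assume pq: "p \<in> GA_rack_carrier G A" "q \<in> GA_rack_carrier G A"
    show "GA_rack_op G p q \<in> GA_rack_carrier G A"
      using GA_rack_op_closed[OF A pq] .
    show "fst (id (GA_rack_op G p q)) = fst (id p)"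
      by (simp add: GA_rack_op_def split: prod.split)
  next
    fix p q s
    assume "p \<in> GA_rack_carrier G A" "q \<in> GA_rack_carrier G A" "s \<in> GA_rack_carrier G A"
      and "(snd (id p), snd (id q)) \<in> r"
    then show "(snd (id (GA_rack_op G p s)), snd (id (GA_rack_op G q s))) \<in> r"
      using A by (auto elim!: GA_rack_carrierE
          simp: GA_rack_op_conjugate conjugate_closed r_mult)
  qed simp
qed

section \<open>A complete invariant of the classes\<close>

text \<open>Two elements \<open>u\<close> and \<open>v\<close> conjugate \<open>b\<close> to the
  same element exactly when \<open>u \<otimes> inv v\<close> commutes with \<open>b\<close>, that
  is, when \<open>u\<close> arises from \<open>v\<close> by left multiplication with an element of
  the centralizer.\<close>

lemma GA_rel_iff:
  assumes A: "A \<subseteq> carrier G" and "p \<in> GA_rack_carrier G A" "q \<in> GA_rack_carrier G A"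
  shows "(p, q) \<in> GA_rel G A \<longleftrightarrow> fst p = fst q \<and> conjugate p = conjugate q"
proof
  assume "(p, q) \<in> GA_rel G A"
  then obtain b v w where h: "p = (b, w \<otimes> v)" "q = (b, v)" "w \<in> carrier G" "v \<in> carrier G"
      "w \<otimes> b = b \<otimes> w" "b \<in> carrier G"
    using A by (auto simp: GA_rel_def element_centralizer_def)
  have "conjugate (b, w) = inv w \<otimes> (w \<otimes> b)"
    using h by (simp add: conjugate_def m_assoc)
  also have "\<dots> = b"
    using h(3,6) by (simp add: m_assoc[symmetric])
  finally show "fst p = fst q \<and> conjugate p = conjugate q"
    using h(1-4,6) by (simp add: conjugate_mult) (simp add: conjugate_def)
next
  assume eq: "fst p = fst q \<and> conjugate p = conjugate q"
  obtain b v where q: "q = (b, v)" "b \<in> A" "b \<in> carrier G" "v \<in> carrier G"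
    using assms(3) A by (rule GA_rack_carrierE)
  obtain u where p: "p = (b, u)" "u \<in> carrier G"
    using assms(2) eq q by (auto simp: GA_rack_carrier_def)
  note c = q p(2)
  \<comment> \<open>The only candidate for the centralizing factor, as
    \<open>u = w \<otimes> v\<close> is required.\<close>
  define w where "w = u \<otimes> inv v"
  have w: "w \<in> carrier G" "u = w \<otimes> v"
    using c by (simp_all add: w_def m_assoc)
  \<comment> \<open>Conjugating by \<open>w\<close> is conjugating by \<open>u\<close> and then by
    \<open>inv v\<close>. Since \<open>u\<close> and \<open>v\<close> give the same conjugate of
    \<open>b\<close>, the second step leads back to \<open>b\<close>.\<close>
  have "conjugate (b, w) = v \<otimes> conjugate (b, v) \<otimes> inv v"
    using eq p q by (simp add: w_def conjugate_mult)
  also have "\<dots> = conjugate (b, v \<otimes> inv v)"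
    using c by (simp only: conjugate_mult inv_closed inv_inv)
  also have "\<dots> = b"
    using c by (simp add: conjugate_def)
  \<comment> \<open>Left multiplication by \<open>w\<close> turns
    \<open>inv w \<otimes> b \<otimes> w = b\<close> into the commutation of \<open>w\<close> with
    \<open>b\<close>.\<close>
  finally have "w \<otimes> (inv w \<otimes> (b \<otimes> w)) = w \<otimes> b"
    using c w by (simp add: conjugate_def m_assoc)
  moreover have "w \<otimes> (inv w \<otimes> (b \<otimes> w)) = w \<otimes> inv w \<otimes> (b \<otimes> w)"
    using c w by (simp only: m_assoc inv_closed m_closed)
  ultimately have "w \<in> element_centralizer G b"
    using c w by (simp add: element_centralizer_def)
  then show "(p, q) \<in> GA_rel G A"
    using p q w(2) unfolding GA_rel_def by blast
qed

lemma GA_quandle_carrierE: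
  assumes "S \<in> GA_quandle_carrier G A"
  obtains a u where "S = GA_rel G A `` {(a, u)}" "(a, u) \<in> GA_rack_carrier G A"
  using assms unfolding GA_quandle_carrier_def by (metis quotientE surj_pair)

text \<open>The pair is constant on each class, so its image there is a singleton and
  \<open>the_elem\<close> reads it off without a choice of representative.\<close>

definition GA_quandle_key :: "('a \<times> 'a) set \<Rightarrow> 'a \<times> 'a" where
  "GA_quandle_key S = the_elem ((\<lambda>p. (fst p, conjugate p)) ` S)"

lemma GA_quandle_key_class:
  assumes "A \<subseteq> carrier G" "p \<in> GA_rack_carrier G A"
  shows "GA_quandle_key (GA_rel G A `` {p}) = (fst p, conjugate p)"
  unfolding GA_quandle_key_def
proof (rule the_elem_image_unique)
  note e = GA_rel_equiv[OF assms(1)]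
  show "GA_rel G A `` {p} \<noteq> {}"
    using equiv_class_self[OF e assms(2)] by blast
  fix q assume q: "q \<in> GA_rel G A `` {p}"
  then have "q \<in> GA_rack_carrier G A"
    using equiv_type[OF e] by auto
  then show "(fst q, conjugate q) = (fst p, conjugate p)"
    using q GA_rel_iff[OF assms] by simp
qed

text \<open>By \<open>GA_rel_iff\<close>, representatives with the same first coordinate and the
  same conjugate are equivalent.\<close>

lemma GA_quandle_key_inj:
  assumes "A \<subseteq> carrier G"
  shows "inj_on GA_quandle_key (GA_quandle_carrier G A)"
proof (rule inj_onI)
  fix S T assume "S \<in> GA_quandle_carrier G A" "T \<in> GA_quandle_carrier G A"
    and eq: "GA_quandle_key S = GA_quandle_key T"
  then obtain p q where pq: "S = GA_rel G A `` {p}" "p \<in> GA_rack_carrier G A"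
      "T = GA_rel G A `` {q}" "q \<in> GA_rack_carrier G A"
    by (auto simp: GA_quandle_carrier_def elim!: quotientE)
  then have "(p, q) \<in> GA_rel G A"
    using eq assms GA_rel_iff[OF assms, of p q]
    by (simp add: GA_quandle_key_class)
  then show "S = T"
    using pq equiv_class_eq[OF GA_rel_equiv[OF assms]] by simp
qed

section \<open>The operation on classes and its order\<close>

text \<open>In this form, closure, division and self-distributivity transfer from the rack to the
  classes.\<close>

lemma GA_quandle_op_GA_rack_op:
  assumes "A \<subseteq> carrier G" "p \<in> GA_rack_carrier G A" "q \<in> GA_rack_carrier G A"
  shows "GA_quandle_op G A (GA_rel G A `` {p}) (GA_rel G A `` {q}) =
    GA_rel G A `` {GA_rack_op G p q}"
  using assms GA_quandle_op_class[OF assms(1)]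
  by (auto simp: GA_rack_carrier_def GA_rack_op_def)

lemma GA_quandle_op_closed:
  assumes "A \<subseteq> carrier G" "S \<in> GA_quandle_carrier G A" "T \<in> GA_quandle_carrier G A"
  shows "GA_quandle_op G A S T \<in> GA_quandle_carrier G A"
  using assms by (auto simp: GA_quandle_carrier_def GA_quandle_op_GA_rack_op GA_rack_op_closed
      elim!: quotientE intro!: quotientI)

text \<open>The rack operation multiplies \<open>u\<close> on the right by
  \<open>conjugate (b, v)\<close>, and conjugating by a product is conjugating successively by its
  factors.\<close>

lemma GA_quandle_key_op:
  assumes A: "A \<subseteq> carrier G" and "S \<in> GA_quandle_carrier G A" "(b, v) \<in> GA_rack_carrier G A"
  shows "GA_quandle_key (GA_quandle_op G A S (GA_rel G A `` {(b, v)})) =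
    (fst (GA_quandle_key S),
     inv (conjugate (b, v)) \<otimes> snd (GA_quandle_key S) \<otimes> conjugate (b, v))"
proof -
  obtain a u where S: "S = GA_rel G A `` {(a, u)}" "(a, u) \<in> GA_rack_carrier G A"
    using assms(2) by (rule GA_quandle_carrierE)
  then have "a \<in> carrier G" "u \<in> carrier G" "b \<in> carrier G" "v \<in> carrier G"
    using assms by (auto simp: GA_rack_carrier_def)
  moreover from this have "GA_rack_op G (a, u) (b, v) = (a, u \<otimes> conjugate (b, v))"
    by (simp add: GA_rack_op_conjugate)
  ultimately show ?thesis
    using S assms GA_rack_op_closed[OF A S(2) assms(3)]
    by (simp add: GA_quandle_op_GA_rack_op GA_quandle_key_class conjugate_mult conjugate_closed)
qed

lemma GA_quandle_right_orderable:
  assumes A: "A \<subseteq> carrier G" and "bi_orderable (carrier G) (mult G)"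
  shows "right_orderable (GA_quandle_carrier G A) (GA_quandle_op G A)"
proof -
  obtain r where r: "strict_linear_order_on (carrier G) r"
    and r_mult: "\<And>x y z. z \<in> carrier G \<Longrightarrow> (x, y) \<in> r \<Longrightarrow> (x \<otimes> z, y \<otimes> z) \<in> r"
      "\<And>x y z. z \<in> carrier G \<Longrightarrow> (x, y) \<in> r \<Longrightarrow> (z \<otimes> x, z \<otimes> y) \<in> r"
    using assms(2) unfolding bi_orderable_def invariant_strict_order_def by blast
  show ?thesis
  proof (rule right_orderable_lex_key[OF r GA_quandle_key_inj[OF A]])
    have "GA_quandle_key S \<in> carrier G \<times> carrier G" if S_in: "S \<in> GA_quandle_carrier G A" for S
    proof -
      obtain a u where S: "S = GA_rel G A `` {(a, u)}" "(a, u) \<in> GA_rack_carrier G A"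
        using S_in by (rule GA_quandle_carrierE)
      then have "a \<in> carrier G" "u \<in> carrier G"
        using A by (auto simp: GA_rack_carrier_def)
      then show ?thesis
        using S by (simp add: GA_quandle_key_class[OF A] conjugate_closed)
    qed
    then show "GA_quandle_key ` GA_quandle_carrier G A \<subseteq> carrier G \<times> carrier G"
      by blast
    fix S T assume ST: "S \<in> GA_quandle_carrier G A" "T \<in> GA_quandle_carrier G A"
    show "GA_quandle_op G A S T \<in> GA_quandle_carrier G A"
      using GA_quandle_op_closed[OF A ST] .
    obtain b v where "T = GA_rel G A `` {(b, v)}" "(b, v) \<in> GA_rack_carrier G A"
      using ST(2) by (rule GA_quandle_carrierE)
    then show "fst (GA_quandle_key (GA_quandle_op G A S T)) = fst (GA_quandle_key S)"
      using A ST by (simp add: GA_quandle_key_op)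
  next
    fix S S' T
    assume ST: "S \<in> GA_quandle_carrier G A" "S' \<in> GA_quandle_carrier G A"
        "T \<in> GA_quandle_carrier G A"
      and less: "(snd (GA_quandle_key S), snd (GA_quandle_key S')) \<in> r"
    obtain b v where T: "T = GA_rel G A `` {(b, v)}" "(b, v) \<in> GA_rack_carrier G A"
      using ST(3) by (rule GA_quandle_carrierE)
    have "conjugate (b, v) \<in> carrier G"
      using A T by (auto simp: GA_rack_carrier_def conjugate_closed)
    \<comment> \<open>Both second coordinates are conjugated by the same element: one left and one
      right multiplication, each of which preserves \<open>r\<close>.\<close>
    then show "(snd (GA_quandle_key (GA_quandle_op G A S T)),
        snd (GA_quandle_key (GA_quandle_op G A S' T))) \<in> r"
      using A ST T less by (simp add: GA_quandle_key_op r_mult)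
  qed
qed

section \<open>The rack and quandle axioms\<close>

lemma GA_rack_rack:
  assumes "A \<subseteq> carrier G" "right_orderable (carrier G) (mult G)"
  shows "rack (GA_rack_carrier G A) (GA_rack_op G)"
  using right_orderable_rackI[OF GA_rack_right_orderable[OF assms] GA_rack_op_closed[OF assms(1)]
      GA_rack_op_solvable[OF assms(1)] GA_rack_op_self_distrib[OF assms(1)]] .

text \<open>Existence of right quotients and self-distributivity descend from representatives;
  uniqueness of right quotients comes from the order on the classes.\<close>

lemma GA_quandle_rack:
  assumes A: "A \<subseteq> carrier G" and "bi_orderable (carrier G) (mult G)"
  shows "rack (GA_quandle_carrier G A) (GA_quandle_op G A)"
proof (rule right_orderable_rackI[OF GA_quandle_right_orderable[OF assms]])
  fix S T assume ST: "S \<in> GA_quandle_carrier G A" "T \<in> GA_quandle_carrier G A"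
  then show "GA_quandle_op G A S T \<in> GA_quandle_carrier G A"
    by (rule GA_quandle_op_closed[OF A])
  obtain p q where pq: "S = GA_rel G A `` {p}" "p \<in> GA_rack_carrier G A"
      "T = GA_rel G A `` {q}" "q \<in> GA_rack_carrier G A"
    using ST by (auto simp: GA_quandle_carrier_def elim!: quotientE)
  then obtain s where "s \<in> GA_rack_carrier G A" "p = GA_rack_op G s q"
    using GA_rack_op_solvable[OF A] by blast
  then show "\<exists>U\<in>GA_quandle_carrier G A. S = GA_quandle_op G A U T"
    using pq by (intro bexI[of _ "GA_rel G A `` {s}"])
      (auto simp: GA_quandle_op_GA_rack_op[OF A] GA_quandle_carrier_def intro: quotientI)
next
  fix S T U
  assume "S \<in> GA_quandle_carrier G A" "T \<in> GA_quandle_carrier G A" "U \<in> GA_quandle_carrier G A"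
  then obtain p q s where "S = GA_rel G A `` {p}" "p \<in> GA_rack_carrier G A"
      "T = GA_rel G A `` {q}" "q \<in> GA_rack_carrier G A"
      "U = GA_rel G A `` {s}" "s \<in> GA_rack_carrier G A"
    unfolding GA_quandle_carrier_def by (metis quotientE)
  then show "GA_quandle_op G A (GA_quandle_op G A S T) U =
      GA_quandle_op G A (GA_quandle_op G A S U) (GA_quandle_op G A T U)"
    using A GA_rack_op_self_distrib[of A p q s]
    by (simp add: GA_quandle_op_GA_rack_op GA_rack_op_closed)
qed

text \<open>Acting by its own class conjugates \<open>conjugate (a, u)\<close> by itself, which
  leaves it fixed. The key is therefore unchanged, and the key determines the class.\<close>

lemma GA_quandle_op_idem:
  assumes A: "A \<subseteq> carrier G" and S: "S \<in> GA_quandle_carrier G A"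
  shows "GA_quandle_op G A S S = S"
proof (rule inj_onD[OF GA_quandle_key_inj[OF A] _ GA_quandle_op_closed[OF A S S] S])
  obtain a u where h: "S = GA_rel G A `` {(a, u)}" "(a, u) \<in> GA_rack_carrier G A"
    using S by (rule GA_quandle_carrierE)
  then have "conjugate (a, u) \<in> carrier G"
    using A by (auto simp: GA_rack_carrier_def conjugate_closed)
  then show "GA_quandle_key (GA_quandle_op G A S S) = GA_quandle_key S"
    using A h S GA_quandle_key_op[OF A S h(2)] by (simp add: GA_quandle_key_class)
qed

text \<open>A quandle is non-empty by definition, whereas an empty \<open>A\<close> would give an
  empty quotient; hence the assumption on \<open>A\<close>.\<close>

lemma GA_quandle_quandle:
  assumes A: "A \<subseteq> carrier G" and "bi_orderable (carrier G) (mult G)" and "A \<noteq> {}"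
  shows "quandle (GA_quandle_carrier G A) (GA_quandle_op G A)"
proof -
  have "GA_rack_carrier G A \<noteq> {}"
    using \<open>A \<noteq> {}\<close> by (auto simp: GA_rack_carrier_def)
  then have "GA_quandle_carrier G A \<noteq> {}"
    by (simp add: GA_quandle_carrier_def)
  then show ?thesis
    using GA_quandle_rack GA_quandle_op_idem assms by (simp add: quandle_def)
qed

end

theorem theorem5p1:
  fixes G :: "('g, 'm) monoid_scheme" and A :: "'g set"
  assumes "group G" and "A \<subseteq> carrier G"
  shows "(right_orderable (carrier G) (mult G) \<longrightarrow>
      rack (GA_rack_carrier G A) (GA_rack_op G) \<and>
      right_orderable (GA_rack_carrier G A) (GA_rack_op G)) \<and>
    (bi_orderable (carrier G) (mult G) \<longrightarrow>
      rack (GA_quandle_carrier G A) (GA_quandle_op G A) \<and>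
      (A \<noteq> {} \<longrightarrow> quandle (GA_quandle_carrier G A) (GA_quandle_op G A)) \<and>
      right_orderable (GA_quandle_carrier G A) (GA_quandle_op G A))"
proof -
  interpret group G by fact
  show ?thesis
    using assms(2) GA_rack_rack GA_rack_right_orderable GA_quandle_rack GA_quandle_quandle
      GA_quandle_right_orderable by blast
qed

end
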